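(* Let $d\ge 1$, let $V$ be a $d$-dimensional real inner-product space, $\mathcal L\subset V$ a full-rank lattice, $\boldsymbol\alpha\in V$, and suppose that the sequence $q_1<q_2<\cdots$ of best approximation denominators of $\boldsymbol\alpha$ with respect to $\mathcal L$ is infinite. Then $$ \liminf_{n\to\infty} q_n^{1/n}\ \ge\ \begin{cases} \dfrac{1+\sqrt5}{2}, & d=1,\\[2mm] 2^{1/(2^d-1)}, & d\ge 2.\end{cases} $$
   Context: Let $\|\cdot\|$ be the norm induced by the inner product of $V$; a full-rank lattice is a discrete subgroup spanning $V$. For integers $q\ge 1$ put $\rho(q)=\min_{p\in\mathcal L}\|q\boldsymbol\alpha-p\|$. The best approximation denominators are defined by $q_1=1$ and $$q_{n+1}=\min\{q\in\mathbb Z: q>q_n,\ \rho(q)<\rho(q_n)\}$$ whenever the set on the right is nonempty; if it is empty, the sequence terminates at $q_n$. *)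

theory Defs
  imports "HOL-Analysis.Analysis"
begin

definition full_rank_lattice :: "'a::euclidean_space set \<Rightarrow> bool" where
  "full_rank_lattice L \<longleftrightarrow>
     0 \<in> L \<and> (\<forall>x\<in>L. \<forall>y\<in>L. x + y \<in> L) \<and> (\<forall>x\<in>L. - x \<in> L) \<and>
     discrete L \<and> span L = UNIV"

text \<open>The least element is a genuine minimum whenever \<open>L\<close> is a full-rank lattice;
  see \<open>approx_error_attained\<close> and \<open>approx_error_le\<close>.\<close>
definition approx_error :: "'a::euclidean_space set \<Rightarrow> 'a \<Rightarrow> nat \<Rightarrow> real" where
  "approx_error L \<alpha> q = (LEAST r. r \<in> (\<lambda>p. norm (real q *\<^sub>R \<alpha> - p)) ` L)"

lemma full_rank_lattice_closed:
  assumes "full_rank_lattice L"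
  shows "closed L"
proof -
  from assms have "0 isolated_in L"
    unfolding full_rank_lattice_def discrete_def by blast
  then obtain e where e: "e > 0" "\<And>y. y \<in> L \<Longrightarrow> dist 0 y < e \<Longrightarrow> y = 0"
    by (rule isolated_inE_dist) blast
  have "x = y" if "x \<in> L" "y \<in> L" "dist x y < e" for x y
  proof -
    have "x + - y \<in> L"
      using assms that(1,2) unfolding full_rank_lattice_def by blast
    then show ?thesis
      using e(2)[of "x - y"] that(3) by (simp add: dist_norm norm_minus_commute)
  qed
  then show ?thesis
    using e(1) uniformI1 uniform_discrete_imp_closed by blast
qed

lemma
  assumes "full_rank_lattice L"
  shows approx_error_attained: "\<exists>p\<in>L. approx_error L \<alpha> q = norm (real q *\<^sub>R \<alpha> - p)"
    and approx_error_le: "p \<in> L \<Longrightarrow> approx_error L \<alpha> q \<le> norm (real q *\<^sub>R \<alpha> - p)"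
proof -
  have "L \<noteq> {}"
    using assms unfolding full_rank_lattice_def by blast
  from distance_attains_inf[OF full_rank_lattice_closed[OF assms] this, of "real q *\<^sub>R \<alpha>"]
  obtain p0 where p0: "p0 \<in> L" "\<And>p. p \<in> L \<Longrightarrow> norm (real q *\<^sub>R \<alpha> - p0) \<le> norm (real q *\<^sub>R \<alpha> - p)"
    unfolding dist_norm by blast
  have "approx_error L \<alpha> q = norm (real q *\<^sub>R \<alpha> - p0)"
    unfolding approx_error_def by (rule Least_equality) (use p0 in auto)
  with p0 show "\<exists>p\<in>L. approx_error L \<alpha> q = norm (real q *\<^sub>R \<alpha> - p)"
    and "p \<in> L \<Longrightarrow> approx_error L \<alpha> q \<le> norm (real q *\<^sub>R \<alpha> - p)"
    by auto
qed

text \<open>Indexed from \<open>1\<close>; \<open>None\<close> at an index \<open>n \<ge> 1\<close> means that the sequence has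
  terminated before reaching its \<open>n\<close>-th term, and index \<open>0\<close> is a dummy.\<close>
fun best_approx_denom :: "'a::euclidean_space set \<Rightarrow> 'a \<Rightarrow> nat \<Rightarrow> nat option" where
  "best_approx_denom L \<alpha> 0 = None"
| "best_approx_denom L \<alpha> (Suc 0) = Some 1"
| "best_approx_denom L \<alpha> (Suc (Suc n)) =
     (case best_approx_denom L \<alpha> (Suc n) of
        None \<Rightarrow> None
      | Some q \<Rightarrow>
          let S = {q'. q' > q \<and> approx_error L \<alpha> q' < approx_error L \<alpha> q}
          in if S = {} then None else Some (LEAST q'. q' \<in> S))"

end

theory Submission
  imports Defs
begin

text \<open>Let \<open>v\<^sub>n = (q\<^sub>n, p\<^sub>n)\<close> be the best approximations in \<open>G = \<int> \<times> L\<close> and \<open>m = 2^d\<close>; the quotient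
  \<open>G/2G\<close> has at most \<open>2m\<close> classes. Halving differences shows that \<open>q\<^sub>j \<ge> 2 q\<^bsub>i+1\<^esub>\<close> whenever
  \<open>i < j\<close> and \<open>v\<^sub>i \<equiv> v\<^sub>j\<close>. If \<open>v\<^sub>i + v\<^sub>j + v\<^sub>k \<in> 2G\<close> with \<open>i < j < k\<close>, the four vectors
  \<open>(v\<^sub>k \<plusminus> v\<^sub>j \<plusminus> v\<^sub>i)/2\<close> lie in \<open>G\<close>, and because the norm is Euclidean the squares of their errors add up
  to the sum of the squared errors of \<open>v\<^sub>i\<close>, \<open>v\<^sub>j\<close>, \<open>v\<^sub>k\<close>; this forces \<open>q\<^sub>k = q\<^sub>i + q\<^sub>j\<close> or
  \<open>q\<^sub>k \<ge> 2 q\<^bsub>i+1\<^esub>\<close>. Suppose \<open>q\<^bsub>n+m\<^esub> < 2 q\<^bsub>n+1\<^esub>\<close>. By the pigeonhole principle each of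
  \<open>v\<^bsub>n+1\<^esub>, \<dots>, v\<^bsub>n+m\<^esub>\<close> lies in such a triple, which must contain \<open>v\<^sub>n\<close>, so these \<open>m\<close> denominators are
  matched with each other by the shift \<open>q\<^sub>n\<close>, and therefore \<open>q\<^bsub>n+m\<^esub> \<ge> q\<^bsub>n+m/2\<^esub> + q\<^sub>n\<close>.
  So one of the two recursive inequalities holds for every \<open>n\<close>, and
  both give at least the claimed growth rate.\<close>

section \<open>Packing and classes modulo two\<close>

text \<open>The balls of radius \<open>e / 2\<close> around the points are disjoint and fit into one
  ball of radius \<open>R + e / 2\<close>; compare volumes.\<close>

lemma packing_bound:
  fixes S :: "'b::euclidean_space set"
  assumes "finite S" "e > 0" "R \<ge> 0" "S \<subseteq> cball 0 R"
    and sep: "\<And>x y. x \<in> S \<Longrightarrow> y \<in> S \<Longrightarrow> x \<noteq> y \<Longrightarrow> e \<le> dist x y"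
  shows "real (card S) * (e / 2) ^ DIM('b) \<le> (R + e / 2) ^ DIM('b)"
proof -
  let ?V = "unit_ball_vol (real DIM('b))"
  have disj: "disjoint_family_on (\<lambda>x. ball x (e / 2)) S"
    unfolding disjoint_family_on_def
  proof (intro ballI impI)
    fix x y assume xy: "x \<in> S" "y \<in> S" "x \<noteq> y"
    have False if "dist x z < e / 2" "dist y z < e / 2" for z
      using sep[OF xy] dist_triangle2[of x y z] that by linarith
    then show "ball x (e / 2) \<inter> ball y (e / 2) = {}" by (auto simp: disjoint_iff)
  qed
  have sub: "(\<Union>x\<in>S. ball x (e / 2)) \<subseteq> ball 0 (R + e / 2)"
  proof (intro UN_least subsetI)
    fix x z assume "x \<in> S" "z \<in> ball x (e / 2)"
    then have "norm x \<le> R" "dist x z < e / 2" using assms(4) by auto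
    moreover have "norm z \<le> norm x + dist x z"
      using dist_triangle[of 0 z x] by simp
    ultimately show "z \<in> ball 0 (R + e / 2)" by simp
  qed
  have "real (card S) * (?V * (e / 2) ^ DIM('b)) = (\<Sum>x\<in>S. measure lborel (ball x (e / 2)))"
    using \<open>e > 0\<close> by (simp add: content_ball)
  also have "\<dots> = measure lborel (\<Union>x\<in>S. ball x (e / 2))"
    by (rule measure_finite_Union[symmetric])
      (use \<open>finite S\<close> disj emeasure_lborel_ball_finite in \<open>auto simp: less_top[symmetric]\<close>)
  also have "\<dots> \<le> measure lborel (ball (0::'b) (R + e / 2))"
    by (rule measure_mono_fmeasurable[OF sub]) (auto intro!: fmeasurableI emeasure_lborel_ball_finite borel_open)
  also have "\<dots> = ?V * (R + e / 2) ^ DIM('b)"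
    using assms by (simp add: content_ball)
  finally have "?V * (real (card S) * (e / 2) ^ DIM('b)) \<le> ?V * (R + e / 2) ^ DIM('b)"
    by (simp add: algebra_simps)
  moreover have "?V > 0" by simp
  ultimately show ?thesis by (simp only: mult_le_cancel_left_pos)
qed

text \<open>Least significant digit first: for digits in \<open>G\<close>, the head of the list
  fixes the class modulo \<open>2G\<close>, so digits can be recovered one at a time.\<close>

fun binary_value :: "('i \<Rightarrow> 'b::real_vector) \<Rightarrow> 'i list \<Rightarrow> 'b" where
  "binary_value f [] = 0"
| "binary_value f (i # s) = f i + 2 *\<^sub>R binary_value f s"

lemma norm_binary_value:
  fixes f :: "'i \<Rightarrow> 'b::real_normed_vector"
  assumes "\<And>i. i \<in> set s \<Longrightarrow> norm (f i) \<le> C"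
  shows "norm (binary_value f s) \<le> (2 ^ length s - 1) * C"
  using assms
proof (induction s)
  case (Cons i s)
  have "norm (binary_value f (i # s)) \<le> norm (f i) + 2 * norm (binary_value f s)"
    using norm_triangle_ineq[of "f i" "2 *\<^sub>R binary_value f s"] by simp
  also have "\<dots> \<le> C + 2 * ((2 ^ length s - 1) * C)"
    using Cons by (intro add_mono mult_left_mono) auto
  finally show ?case by (simp add: algebra_simps)
qed simp

text \<open>If the values of \<open>f\<close> were pairwise incongruent modulo \<open>2G\<close>, binary expansions of length
  \<open>k\<close> with these digits would be distinct points of \<open>G\<close> of norm \<open>O(2^k)\<close>; there are
  \<open>card I ^ k\<close> of them, too many for a packing when \<open>card I\<close> exceeds \<open>2 ^ dim\<close>.\<close>
lemma pigeonhole_mod_two: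
  fixes G :: "'b::euclidean_space set" and f :: "'i \<Rightarrow> 'b"
  assumes zero: "0 \<in> G" and add: "\<And>x y. x \<in> G \<Longrightarrow> y \<in> G \<Longrightarrow> x + y \<in> G"
    and minus: "\<And>x. x \<in> G \<Longrightarrow> - x \<in> G"
    and e: "e > 0" "\<And>x. x \<in> G \<Longrightarrow> norm x < e \<Longrightarrow> x = 0"
    and I: "finite I" "\<And>i. i \<in> I \<Longrightarrow> f i \<in> G" "2 ^ DIM('b) < card I"
  shows "\<exists>i\<in>I. \<exists>j\<in>I. i \<noteq> j \<and> (\<exists>g\<in>G. f i - f j = 2 *\<^sub>R g)"
proof (rule ccontr)
  assume neg: "\<not> ?thesis"
  have diff: "x - y \<in> G" if "x \<in> G" "y \<in> G" for x y
    using add[OF that(1) minus[OF that(2)]] by simp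
  define C where "C = Max (insert 0 ((\<lambda>i. norm (f i)) ` I))"
  have C: "C \<ge> 0" "\<And>i. i \<in> I \<Longrightarrow> norm (f i) \<le> C"
    using I(1) by (auto simp: C_def)
  define W where "W k = {s. set s \<subseteq> I \<and> length s = k}" for k
  have inG: "binary_value f s \<in> G" if "set s \<subseteq> I" for s
    using that by (induction s) (auto simp: zero add I(2) scaleR_2)
  have inj: "s = t" if "set s \<subseteq> I" "set t \<subseteq> I" "length s = length t"
    "binary_value f s = binary_value f t" for s t
    using that
  proof (induction s arbitrary: t)
    case (Cons i s)
    then obtain j t' where t: "t = j # t'" by (cases t) auto
    have "f i - f j = 2 *\<^sub>R (binary_value f t' - binary_value f s)"
      using Cons.prems by (simp add: t algebra_simps)
    moreover have "binary_value f t' - binary_value f s \<in> G"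
      using Cons.prems by (intro diff inG) (auto simp: t)
    moreover have "i \<in> I" "j \<in> I" using Cons.prems by (auto simp: t)
    ultimately have "i = j" using neg by blast
    then show ?case using Cons by (auto simp: t)
  qed simp
  \<comment> \<open>Chosen so that \<open>A * (e / 2) = C + e / 2\<close>; the powers of
    \<open>e / 2\<close> then cancel, and \<open>A\<close> does not depend on
    \<open>k\<close>.\<close>
  define A where "A = 2 * C / e + 1"
  have bound: "real (card I) ^ k \<le> (2 ^ k * A) ^ DIM('b)" for k
  proof -
    let ?S = "binary_value f ` W k"
    have "real (card ?S) * (e / 2) ^ DIM('b) \<le> (2 ^ k * C + e / 2) ^ DIM('b)"
    proof (rule packing_bound)
      show "finite ?S" using finite_lists_length_eq[OF I(1)] by (simp add: W_def)
      show "?S \<subseteq> cball 0 (2 ^ k * C)"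
      proof (intro subsetI, elim imageE)
        fix x s assume s: "s \<in> W k" and x: "x = binary_value f s"
        have "norm x \<le> (2 ^ length s - 1) * C"
          unfolding x by (rule norm_binary_value) (use s C in \<open>auto simp: W_def\<close>)
        also have "\<dots> \<le> 2 ^ k * C"
          using s C(1) by (intro mult_right_mono) (auto simp: W_def)
        finally show "x \<in> cball 0 (2 ^ k * C)" by simp
      qed
      fix x y assume "x \<in> ?S" "y \<in> ?S" "x \<noteq> y"
      moreover from this have "x - y \<in> G" by (auto simp: W_def intro!: diff inG)
      ultimately show "e \<le> dist x y"
        using e(2)[of "x - y"] by (force simp: dist_norm)
    qed (use C e in auto)
    moreover have "card ?S = card I ^ k"
    proof -
      have "inj_on (binary_value f) (W k)" by (auto simp: W_def intro!: inj_onI inj)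
      then show ?thesis
        using card_lists_length_eq[OF I(1), of k] by (simp add: card_image W_def)
    qed
    moreover have "2 ^ k * C + e / 2 \<le> (2 ^ k * A) * (e / 2)"
      using e(1) by (simp add: A_def field_simps)
    then have "(2 ^ k * C + e / 2) ^ DIM('b) \<le> (2 ^ k * A) ^ DIM('b) * (e / 2) ^ DIM('b)"
      using C e(1) by (subst power_mult_distrib[symmetric], intro power_mono) auto
    ultimately have "real (card I) ^ k * (e / 2) ^ DIM('b) \<le> (2 ^ k * A) ^ DIM('b) * (e / 2) ^ DIM('b)"
      by simp
    then show ?thesis using e(1) by (simp add: mult_le_cancel_right)
  qed
  have "1 < real (card I) / 2 ^ DIM('b)"
    using I(3) by (simp add: divide_simps)
  from real_arch_pow[OF this] obtain k
    where "A ^ DIM('b) < (real (card I) / 2 ^ DIM('b)) ^ k" by blast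
  moreover have "(2 ^ k * A) ^ DIM('b) = A ^ DIM('b) * (2 ^ DIM('b)) ^ k"
    by (simp add: power_mult_distrib flip: power_mult)
  ultimately show False
    using bound[of k] by (simp add: power_divide field_simps)
qed

section \<open>Records of the approximation error\<close>

locale best_approximations =
  fixes L :: "'a::euclidean_space set" and \<alpha> :: 'a and q :: "nat \<Rightarrow> nat"
  assumes lattice: "full_rank_lattice L"
    and denom: "\<And>n. n \<ge> 1 \<Longrightarrow> best_approx_denom L \<alpha> n = Some (q n)"
begin

abbreviation \<rho> :: "nat \<Rightarrow> real" where "\<rho> \<equiv> approx_error L \<alpha>"

lemma q_1: "q 1 = 1"
  using denom[of 1] by simp

lemma q_step:
  assumes "n \<ge> 1"
  shows "q n < q (Suc n)" "\<rho> (q (Suc n)) < \<rho> (q n)"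
    and "\<And>t. q n < t \<Longrightarrow> \<rho> t < \<rho> (q n) \<Longrightarrow> q (Suc n) \<le> t"
proof -
  let ?S = "{t. t > q n \<and> \<rho> t < \<rho> (q n)}"
  obtain k where k: "n = Suc k" using assms by (cases n) auto
  have *: "?S \<noteq> {}" "q (Suc n) = (LEAST t. t \<in> ?S)"
    using denom[of "Suc n"] denom[of n] assms unfolding k
    by (auto simp: Let_def split: if_splits)
  then have "q (Suc n) \<in> ?S" by (metis LeastI ex_in_conv)
  then show "q n < q (Suc n)" "\<rho> (q (Suc n)) < \<rho> (q n)" by auto
  show "q (Suc n) \<le> t" if "q n < t" "\<rho> t < \<rho> (q n)" for t
    unfolding *(2) by (rule Least_le) (use that in auto)
qed

lemma q_less:
  assumes "1 \<le> i" "i < j"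
  shows "q i < q j"
proof -
  have "1 \<le> i \<longrightarrow> q i < q j"
    using assms(2) by (induction rule: less_Suc_induct) (use q_step in \<open>auto\<close>)
  then show ?thesis using assms by simp
qed

lemma q_le: "1 \<le> i \<Longrightarrow> i \<le> j \<Longrightarrow> q i \<le> q j"
  using q_less[of i j] by (cases "i = j") auto

lemma error_less:
  assumes "1 \<le> i" "i < j"
  shows "\<rho> (q j) < \<rho> (q i)"
proof -
  have "1 \<le> i \<longrightarrow> \<rho> (q j) < \<rho> (q i)"
    using assms(2) by (induction rule: less_Suc_induct) (use q_step in \<open>auto\<close>)
  then show ?thesis using assms by simp
qed

lemma q_pos: "1 \<le> i \<Longrightarrow> 0 < q i"
  using q_le[of 1 i] q_1 by simp

text \<open>The definition compares only with \<open>t > q i\<close>. Induction removes this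
  restriction: beating the current record means beating the previous one, which already forces
  \<open>q i \<le> t\<close>, and equality is impossible.\<close>

lemma next_denom_le:
  assumes "1 \<le> i" "0 < t" "\<rho> t < \<rho> (q i)"
  shows "q (Suc i) \<le> t"
  using assms
proof (induction i rule: dec_induct)
  case base
  then show ?case using q_step(3)[of 1 t] q_1 by (cases "t = 1") auto
next
  case (step i)
  then have "\<rho> t < \<rho> (q i)" using q_step(2)[of i] by simp
  then have "q (Suc i) \<le> t" using step by simp
  then show ?case using step q_step(3)[of "Suc i" t] by (cases "t = q (Suc i)") auto
qed

lemma error_gt:
  assumes "1 \<le> i" "0 < t" "t < q i"
  shows "\<rho> (q i) < \<rho> t"
proof (cases "i = 1")
  case False
  then obtain k where k: "i = Suc k" "1 \<le> k" using assms by (cases i) auto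
  then have "\<rho> (q k) \<le> \<rho> t" using next_denom_le[of k t] assms by force
  then show ?thesis using q_step(2)[of k] k by simp
qed (use assms q_1 in auto)

section \<open>Approximations as vectors of a discrete group\<close>

text \<open>The integers are embedded in the reals so that \<open>G\<close> lies in a Euclidean
  space of dimension \<open>DIM('a) + 1\<close>, where packing applies.\<close>

definition G :: "(real \<times> 'a) set" where
  "G = \<int> \<times> L"

definition err :: "real \<times> 'a \<Rightarrow> 'a" where
  "err g = fst g *\<^sub>R \<alpha> - snd g"

definition p :: "nat \<Rightarrow> 'a" where
  "p i = (SOME x. x \<in> L \<and> \<rho> (q i) = norm (real (q i) *\<^sub>R \<alpha> - x))"

definition v :: "nat \<Rightarrow> real \<times> 'a" where
  "v i = (real (q i), p i)"

lemma p: "p i \<in> L" "\<rho> (q i) = norm (real (q i) *\<^sub>R \<alpha> - p i)"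
  using someI_ex[OF approx_error_attained[OF lattice, of \<alpha> "q i", unfolded Bex_def]]
  unfolding p_def by auto

lemma fst_v [simp]: "fst (v i) = real (q i)"
  by (simp add: v_def)

lemma norm_err_v: "norm (err (v i)) = \<rho> (q i)"
  using p(2)[of i] by (simp add: err_def v_def)

lemma err_linear:
  "err (x + y) = err x + err y" "err (x - y) = err x - err y" "err (c *\<^sub>R x) = c *\<^sub>R err x"
  by (simp_all add: err_def algebra_simps)

lemma G_closed:
  shows "0 \<in> G" "x \<in> G \<Longrightarrow> y \<in> G \<Longrightarrow> x + y \<in> G" "x \<in> G \<Longrightarrow> - x \<in> G"
    and "x \<in> G \<Longrightarrow> y \<in> G \<Longrightarrow> x - y \<in> G"
proof -
  show *: "0 \<in> G" "x \<in> G \<Longrightarrow> y \<in> G \<Longrightarrow> x + y \<in> G" "x \<in> G \<Longrightarrow> - x \<in> G" for x y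
    using lattice by (auto simp: G_def full_rank_lattice_def mem_Times_iff)
  show "x - y \<in> G" if "x \<in> G" "y \<in> G"
    using *(2)[OF that(1) *(3)[OF that(2)]] by simp
qed

lemma v_in_G: "v i \<in> G"
  using p(1) by (simp add: v_def G_def)

lemma G_discrete: "\<exists>e>0. \<forall>x\<in>G. norm x < e \<longrightarrow> x = 0"
proof -
  have "0 isolated_in L"
    using lattice unfolding full_rank_lattice_def discrete_def by blast
  then obtain e where e: "e > 0" "\<And>y. y \<in> L \<Longrightarrow> dist 0 y < e \<Longrightarrow> y = 0"
    by (rule isolated_inE_dist) blast
  have "x = 0" if x: "x \<in> G" "norm x < min 1 e" for x
  proof -
    have "\<bar>fst x\<bar> < 1" "norm (snd x) < e"
      using x(2) norm_fst_le[of "fst x" "snd x"] norm_snd_le[of "snd x" "fst x"] by auto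
    moreover have "fst x \<in> \<int>" "snd x \<in> L" using x(1) by (auto simp: G_def)
    ultimately show ?thesis
      using e(2)[of "snd x"] Ints_nonzero_abs_less1 by (auto simp: prod_eq_iff)
  qed
  then show ?thesis using e(1) by (intro exI[of _ "min 1 e"]) auto
qed

lemma error_le_norm_err:
  assumes "g \<in> G" "0 < fst g"
  obtains t where "fst g = real t" "0 < t" "\<rho> t \<le> norm (err g)"
proof -
  obtain a where a: "fst g = of_int a" using assms(1) by (auto simp: G_def elim: Ints_cases)
  with assms have "fst g = real (nat a)" "0 < nat a" by auto
  moreover from this have "\<rho> (nat a) \<le> norm (err g)"
    using assms(1) approx_error_le[OF lattice, of "snd g" \<alpha> "nat a"] by (auto simp: err_def G_def)
  ultimately show thesis by (rule that)
qed

lemma fst_ge_next: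
  assumes "g \<in> G" "0 < fst g" "1 \<le> i" "norm (err g) < \<rho> (q i)"
  shows "real (q (Suc i)) \<le> fst g"
  using error_le_norm_err[OF assms(1,2)] next_denom_le[OF assms(3)] assms(4)
  by (metis of_nat_le_iff order_le_less_trans)

lemma norm_err_gt:
  assumes "g \<in> G" "0 < fst g" "fst g < real (q i)" "1 \<le> i"
  shows "\<rho> (q i) < norm (err g)"
  using error_le_norm_err[OF assms(1,2)] error_gt[OF assms(4)] assms(3)
  by (metis of_nat_less_iff order_less_le_trans)

section \<open>Growth forced by relations modulo two\<close>

text \<open>Halving \<open>v i\<close> would halve both its denominator and its error, contradicting
  that smaller denominators have larger errors.\<close>

lemma v_not_even:
  assumes "1 \<le> i" "g \<in> G"
  shows "v i \<noteq> 2 *\<^sub>R g"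
proof
  assume eq: "v i = 2 *\<^sub>R g"
  from arg_cong[OF eq, of fst] have f: "real (q i) = 2 * fst g" by simp
  have "norm (err (v i)) = 2 * norm (err g)" by (simp add: eq err_linear)
  moreover have "\<rho> (q i) < norm (err g)"
    using norm_err_gt[OF assms(2), of i] f q_pos[OF assms(1)] assms(1) by simp
  ultimately show False using norm_ge_zero[of "err g"] by (simp only: norm_err_v)
qed

text \<open>By the triangle inequality the half-difference \<open>g\<close> has error below
  \<open>\<rho> (q i)\<close>, so its denominator \<open>(q j - q i) / 2\<close> is at least
  \<open>q (Suc i)\<close>.\<close>

lemma congruent_pair_growth:
  assumes "1 \<le> i" "i < j" "g \<in> G" "v j - v i = 2 *\<^sub>R g"
  shows "2 * q (Suc i) \<le> q j"
proof -
  from arg_cong[OF assms(4), of fst] have f: "real (q j) - real (q i) = 2 * fst g" by simp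
  have "2 * norm (err g) = norm (err (v j) - err (v i))"
    using arg_cong[OF assms(4), of err] by (simp add: err_linear)
  also have "\<dots> \<le> \<rho> (q j) + \<rho> (q i)"
    using norm_triangle_ineq4[of "err (v j)" "err (v i)"] by (simp add: norm_err_v)
  also have "\<dots> < 2 * \<rho> (q i)" using error_less[OF assms(1,2)] by simp
  finally have "real (q (Suc i)) \<le> fst g"
    using fst_ge_next[OF assms(3)] f q_less[OF assms(1,2)] assms(1) by simp
  then show ?thesis using f by linarith
qed

lemma zero_sum_triple_growth:
  assumes "1 \<le> i" "i < j" "j < k" "g \<in> G" "v i + v j + v k = 2 *\<^sub>R g"
  shows "q k = q j + q i \<or> 2 * q (Suc i) \<le> q k"
proof (rule ccontr)
  assume neg: "\<not> ?thesis"
  define x y z where xyz: "x = err (v i)" "y = err (v j)" "z = err (v k)"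
  \<comment> \<open>These are \<open>(v k - v j + v i) / 2\<close>,
    \<open>(v k - v j - v i) / 2\<close> and \<open>(v k + v j - v i) / 2\<close>, written through
    \<open>g\<close> so that membership in \<open>G\<close> is immediate.\<close>
  define a b c where abc: "a = g - v j" "b = g - v j - v i" "c = g - v i"
  have G: "a \<in> G" "b \<in> G" "- b \<in> G" "c \<in> G"
    unfolding abc by (intro G_closed assms v_in_G)+
  have g2: "2 * fst g = real (q i) + real (q j) + real (q k)"
    using arg_cong[OF assms(5), of fst] by simp
  have "x + y + z = 2 *\<^sub>R err g"
    using arg_cong[OF assms(5), of err] by (simp add: err_linear xyz)
  then have eg: "err g = (1/2) *\<^sub>R (x + y + z)" by simp
  have q: "real (q i) < real (q j)" "real (q j) < real (q k)" "0 < real (q i)"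
    using q_less q_pos assms by auto
  have ea: "err a = (1/2) *\<^sub>R (z - y + x)" "err b = (1/2) *\<^sub>R (z - y - x)"
    "err c = (1/2) *\<^sub>R (z + y - x)"
    unfolding abc err_linear eg xyz[symmetric]
    by (simp_all add: euclidean_eq_iff[where 'a='a] inner_simps field_simps)
  have \<rho>: "\<rho> (q i) = norm x" "\<rho> (q j) = norm y" "\<rho> (q k) = norm z"
    by (simp_all add: xyz norm_err_v)
  have lt: "norm y < norm x" "norm z < norm y"
    using error_less assms by (simp_all flip: \<rho>)
  \<comment> \<open>A smaller error would give
    \<open>2 * q (Suc i) \<le> q k - q j + q i < q k\<close>.\<close>
  have A: "norm x \<le> norm (err a)"
    using fst_ge_next[OF G(1) _ assms(1)] g2 q neg by (fastforce simp: abc \<rho>)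
  \<comment> \<open>The excluded equality \<open>q k = q j + q i\<close> makes \<open>fst b\<close>
    nonzero. Its sign is unknown, so \<open>b\<close> or \<open>- b\<close> serves; the denominator
    of \<open>- b\<close> would be below \<open>q i\<close>.\<close>
  have B: "norm x \<le> norm (err b)"
  proof (rule ccontr)
    assume less: "\<not> ?thesis"
    have fb: "2 * fst b = real (q k) - real (q j) - real (q i)" using g2 by (simp add: abc)
    have "fst b \<noteq> 0" using fb neg by (auto simp flip: of_nat_add)
    then consider "0 < fst b" | "0 < fst (- b)" by force
    then show False
    proof cases
      case 1
      then show False using fst_ge_next[OF G(2) 1 assms(1)] less fb q neg by (simp add: \<rho>)
    next
      case 2
      have "norm (err (- b)) = norm (err b)" by (simp add: err_def norm_minus_commute)
      then show False
        using fst_ge_next[OF G(3) 2 assms(1)] less fb q neg q_less[OF assms(1), of "Suc i"]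
        by (simp add: \<rho>)
    qed
  qed
  \<comment> \<open>The denominator \<open>(q k + q j - q i) / 2\<close> lies strictly between
    \<open>0\<close> and \<open>q k\<close>.\<close>
  have C: "norm z < norm (err c)"
    using norm_err_gt[OF G(4), of k] g2 q assms by (simp add: abc \<rho>)
  \<comment> \<open>The mixed terms cancel over the four sign patterns. The lower bounds make the
    left side exceed \<open>2 * (norm x)\<^sup>2 + (norm z)\<^sup>2\<close>, although
    \<open>norm y < norm x\<close>.\<close>
  have sum_squares: "(norm (err a))\<^sup>2 + (norm (err b))\<^sup>2 + (norm (err c))\<^sup>2 + (norm (err g))\<^sup>2
      = (norm x)\<^sup>2 + (norm y)\<^sup>2 + (norm z)\<^sup>2"
    unfolding ea eg power2_norm_eq_inner
    by (simp add: inner_simps inner_commute field_simps)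
  have "(norm x)\<^sup>2 \<le> (norm (err a))\<^sup>2" "(norm x)\<^sup>2 \<le> (norm (err b))\<^sup>2"
    "(norm z)\<^sup>2 < (norm (err c))\<^sup>2" "(norm y)\<^sup>2 < (norm x)\<^sup>2"
    using A B C lt by (auto intro: power_mono power_strict_mono)
  then show False using sum_squares zero_le_power2[of "norm (err g)"] by linarith
qed

section \<open>Triples in a window of indices\<close>

text \<open>Compare the classes of \<open>v i\<close> and \<open>v i + v l\<close> for
  \<open>i \<noteq> l\<close>. Two of the same type cannot collide, by
  \<open>congruent_pair_growth\<close> and \<open>no\<close>; a collision of different types is the
  required relation.\<close>

lemma ex_zero_sum_triple:
  assumes n: "1 \<le> n" and l: "l \<in> {n..n + 2 ^ DIM('a)}"
    and no: "q (n + 2 ^ DIM('a)) < 2 * q (Suc n)"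
  shows "\<exists>i\<in>{n..n + 2 ^ DIM('a)}. \<exists>j\<in>{n..n + 2 ^ DIM('a)}. i \<noteq> j \<and> i \<noteq> l \<and> j \<noteq> l \<and>
    (\<exists>g\<in>G. v i + v j + v l = 2 *\<^sub>R g)"
proof -
  define N where "N = {n..n + 2 ^ DIM('a)}"
  have sym: "\<exists>g\<in>G. v j - v i = 2 *\<^sub>R g" if "\<exists>g\<in>G. v i - v j = 2 *\<^sub>R g" for i j
    using that G_closed(3) by (metis minus_diff_eq scaleR_minus_right)
  have incong: "\<not> (\<exists>g\<in>G. v i - v j = 2 *\<^sub>R g)" if "i \<in> N" "j \<in> N" "i \<noteq> j" for i j
  proof -
    have *: False if "i \<in> N" "j \<in> N" "i < j" "\<exists>g\<in>G. v j - v i = 2 *\<^sub>R g" for i j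
    proof -
      have "2 * q (Suc i) \<le> q j" using congruent_pair_growth[of i j] that n by (auto simp: N_def)
      moreover have "q j \<le> q (n + 2 ^ DIM('a))" "q (Suc n) \<le> q (Suc i)"
        using that n by (auto simp: N_def intro!: q_le)
      ultimately show False using no by simp
    qed
    show ?thesis using *[of i j] *[of j i] sym that by (metis linorder_neq_iff)
  qed
  define f where "f = (\<lambda>(i, b). v i + (if b then v l else 0))"
  \<comment> \<open>The pair \<open>(l, True)\<close> has value \<open>2 *\<^sub>R v l\<close>, the
    zero class; it raises the count to one more than \<open>2 ^ (DIM('a) + 1)\<close>.\<close>
  define I where "I = insert (l, True) ((N - {l}) \<times> UNIV)"
  have "card I = Suc (2 * card (N - {l}))"
    unfolding I_def by (subst card_insert_disjoint) (auto simp: N_def card_cartesian_product)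
  also have "card (N - {l}) = 2 ^ DIM('a)" using l by (simp add: N_def)
  finally have "2 ^ DIM(real \<times> 'a) < card I" by simp
  moreover obtain e where "e > 0" "\<And>x. x \<in> G \<Longrightarrow> norm x < e \<Longrightarrow> x = 0"
    using G_discrete by blast
  ultimately have "\<exists>s\<in>I. \<exists>t\<in>I. s \<noteq> t \<and> (\<exists>g\<in>G. f s - f t = 2 *\<^sub>R g)"
    by (intro pigeonhole_mod_two[of G e])
      (auto simp: G_closed I_def N_def f_def v_in_G split: if_splits)
  then obtain i b j c g where ij: "(i, b) \<in> I" "(j, c) \<in> I" "(i, b) \<noteq> (j, c)" and g: "g \<in> G"
    and eq: "f (i, b) - f (j, c) = 2 *\<^sub>R g" by (metis surj_pair)
  have ijN: "i \<in> N" "j \<in> N" using ij l by (auto simp: I_def N_def)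
  have pos: "1 \<le> i" "1 \<le> j" "1 \<le> l" using ijN n l by (auto simp: N_def)
  have "b \<noteq> c"
  proof
    assume "b = c"
    then have "i \<noteq> j" "v i - v j = 2 *\<^sub>R g" using ij eq by (auto simp: f_def)
    then show False using incong ijN g by blast
  qed
  have "\<exists>h\<in>G. v i + v j + v l = 2 *\<^sub>R h"
  proof (cases b)
    case True
    then have "v i + v l - v j = 2 *\<^sub>R g" using eq \<open>b \<noteq> c\<close> by (simp add: f_def)
    then have "v i + v j + v l = 2 *\<^sub>R (g + v j)" by (simp add: algebra_simps scaleR_2)
    then show ?thesis using G_closed(2) g v_in_G by blast
  next
    case False
    then have "v i - (v j + v l) = 2 *\<^sub>R g" using eq \<open>b \<noteq> c\<close> by (simp add: f_def)
    then have "v i + v j + v l = 2 *\<^sub>R (g + v j + v l)" by (simp add: algebra_simps scaleR_2)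
    then show ?thesis using G_closed(2) g v_in_G by blast
  qed
  then obtain h where h: "h \<in> G" "v i + v j + v l = 2 *\<^sub>R h" by blast
  \<comment> \<open>A repeated index would make the remaining vector even; this also excludes a
    collision with the zero class.\<close>
  have even: False if "v s + v s + v t = 2 *\<^sub>R h" "1 \<le> t" for s t
  proof -
    have "v t = 2 *\<^sub>R (h - v s)" using that by (simp add: algebra_simps scaleR_2)
    then show False using v_not_even that(2) G_closed(4) h(1) v_in_G by blast
  qed
  have "i \<noteq> j" using even[of i l] h pos by auto
  moreover have "i \<noteq> l" using even[of i j] h pos by (auto simp: algebra_simps)
  moreover have "j \<noteq> l" using even[of j i] h pos by (auto simp: algebra_simps)
  ultimately show ?thesis using ijN h unfolding N_def by blast
qed

text \<open>The upper bound on \<open>q (n + m)\<close> rules out the doubling alternative, and also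
  \<open>i > n\<close>, since then \<open>q j + q i \<ge> 2 * q (Suc n)\<close>.\<close>

lemma zero_sum_triple_contains_start:
  assumes "1 \<le> n" "n \<le> i" "i < j" "j < k" "k \<le> n + m" "q (n + m) < 2 * q (Suc n)"
    and "\<exists>g\<in>G. v i + v j + v k = 2 *\<^sub>R g"
  shows "i = n \<and> q k = q j + q n"
proof -
  have "q (Suc n) \<le> q (Suc i)" "q k \<le> q (n + m)" using assms by (auto intro: q_le)
  moreover have "q k = q j + q i \<or> 2 * q (Suc i) \<le> q k"
    using zero_sum_triple_growth[of i j k] assms by auto
  ultimately have *: "q k = q j + q i" using assms by linarith
  have "i = n"
  proof (rule ccontr)
    assume "i \<noteq> n"
    then have "q (Suc n) \<le> q i" "q (Suc n) \<le> q j" using assms by (auto intro: q_le)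
    then show False using * \<open>q k \<le> q (n + m)\<close> assms by linarith
  qed
  with * show ?thesis by simp
qed

text \<open>Any triple through \<open>l\<close> has \<open>n\<close> as its least index. As
  \<open>l > n\<close>, the third index is the partner, on either side of \<open>l\<close>.\<close>

lemma ex_partner:
  assumes "1 \<le> n" "l \<in> {n<..n + 2 ^ DIM('a)}"
    and no: "q (n + 2 ^ DIM('a)) < 2 * q (Suc n)"
  shows "\<exists>j\<in>{n<..n + 2 ^ DIM('a)}. q l = q j + q n \<or> q j = q l + q n"
proof -
  define m :: nat where "m = 2 ^ DIM('a)"
  obtain i j where ij: "i \<in> {n..n + m}" "j \<in> {n..n + m}" "i \<noteq> j" "i \<noteq> l" "j \<noteq> l"
    "\<exists>g\<in>G. v i + v j + v l = 2 *\<^sub>R g"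
    using ex_zero_sum_triple[OF assms(1) _ no, of l] assms(2) unfolding m_def
    by (metis atLeastAtMost_iff greaterThanAtMost_iff less_imp_le)
  have "\<exists>i j. i < j \<and> i \<in> {n..n + m} \<and> j \<in> {n..n + m} \<and> i \<noteq> l \<and> j \<noteq> l \<and>
     (\<exists>g\<in>G. v i + v j + v l = 2 *\<^sub>R g)"
  proof (cases "i < j")
    case True
    then show ?thesis using ij by blast
  next
    case False
    then have "j < i" using ij by simp
    then show ?thesis using ij by (metis add.commute)
  qed
  then obtain i j where ij: "i < j" "i \<in> {n..n + m}" "j \<in> {n..n + m}" "i \<noteq> l" "j \<noteq> l"
     "\<exists>g\<in>G. v i + v j + v l = 2 *\<^sub>R g" by blast
  note start = zero_sum_triple_contains_start[OF assms(1) _ _ _ _ no[folded m_def]]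
  consider "l < i" | "i < l" "l < j" | "j < l" using ij by linarith
  then show ?thesis
  proof cases
    case 1
    then have False using start[of l i j] ij assms by (auto simp: add_ac)
    then show ?thesis ..
  next
    case 2
    then have "q j = q l + q n" using start[of i l j] ij by (auto simp: add_ac)
    then show ?thesis using ij unfolding m_def by auto
  next
    case 3
    then have "q l = q j + q n" using start[of i j l] ij assms unfolding m_def by (auto simp: add_ac)
    then show ?thesis using ij unfolding m_def by auto
  qed
qed

text \<open>If both alternatives fail, an \<open>l \<ge> n + h\<close> has no partner above it,
  since \<open>q l + q n\<close> would exceed \<open>q (n + m)\<close>. Its partner below has index
  strictly between \<open>n\<close> and \<open>n + h\<close>, so \<open>h + 1\<close> indices inject
  into \<open>h - 1\<close>.\<close>

lemma growth:
  assumes n: "1 \<le> n"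
  shows "2 * q (Suc n) \<le> q (n + 2 ^ DIM('a)) \<or>
    q (n + 2 ^ (DIM('a) - 1)) + q n \<le> q (n + 2 ^ DIM('a))"
proof (rule disjCI, rule ccontr)
  define m h :: nat where mh: "m = 2 ^ DIM('a)" "h = 2 ^ (DIM('a) - 1)"
  have m: "m = 2 * h" using DIM_positive[where 'a='a] by (simp add: mh flip: power_Suc)
  assume "\<not> q (n + 2 ^ (DIM('a) - 1)) + q n \<le> q (n + 2 ^ DIM('a))"
  then have lt: "q (n + m) < q (n + h) + q n" by (simp add: mh)
  assume "\<not> 2 * q (Suc n) \<le> q (n + 2 ^ DIM('a))"
  then have no: "q (n + m) < 2 * q (Suc n)" by (simp add: mh)
  have "\<exists>j\<in>{n<..n + m}. q l = q j + q n" if l: "l \<in> {n + h..n + m}" for l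
  proof -
    have "n + h > n" by (simp add: mh)
    then have "l \<in> {n<..n + m}" using l by auto
    then obtain j where j: "j \<in> {n<..n + m}" "q l = q j + q n \<or> q j = q l + q n"
      using ex_partner[OF n, of l] no by (auto simp: mh)
    have "q j \<le> q (n + m)" "q (n + h) \<le> q l" using j l n by (auto intro: q_le)
    then show ?thesis using j lt by force
  qed
  then obtain t where t: "\<And>l. l \<in> {n + h..n + m} \<Longrightarrow> t l \<in> {n<..n + m} \<and> q l = q (t l) + q n"
    by metis
  have "t ` {n + h..n + m} \<subseteq> {n<..<n + h}"
  proof (intro image_subsetI)
    fix l assume l: "l \<in> {n + h..n + m}"
    then have "q l \<le> q (n + m)" using n by (auto intro: q_le)
    then have "q (t l) < q (n + h)" using t[OF l] lt by simp
    then have "t l < n + h" using q_le[of "n + h" "t l"] n by force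
    then show "t l \<in> {n<..<n + h}" using t[OF l] by simp
  qed
  moreover have "inj_on t {n + h..n + m}"
  proof (rule inj_onI)
    fix k l assume *: "k \<in> {n + h..n + m}" "l \<in> {n + h..n + m}" "t k = t l"
    then have "q k = q l" using t by simp
    then show "k = l" using q_less[of k l] q_less[of l k] * n
      by (metis atLeastAtMost_iff le_trans le_add1 less_irrefl linorder_neq_iff)
  qed
  ultimately have "card {n + h..n + m} \<le> card {n<..<n + h}" by (intro card_inj_on_le) auto
  then show False using m by simp
qed

section \<open>From the recursion to the growth rate\<close>

text \<open>The two conditions on \<open>r\<close> match the two alternatives of
  \<open>growth\<close>: doubling over \<open>m - 1\<close> steps, and the recurrence with shifts
  \<open>m\<close> and \<open>h\<close>. The factor \<open>r ^ m\<close> absorbs the first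
  \<open>m\<close> indices.\<close>

lemma exponential_lower_bound:
  fixes r :: real
  assumes r: "1 \<le> r" "r ^ (2 ^ DIM('a) - 1) \<le> 2" "r ^ 2 ^ DIM('a) \<le> r ^ 2 ^ (DIM('a) - 1) + 1"
    and "1 \<le> n"
  shows "r ^ n \<le> r ^ 2 ^ DIM('a) * real (q n)"
  using \<open>1 \<le> n\<close>
proof (induction n rule: less_induct)
  case (less n)
  define m h :: nat where mh: "m = 2 ^ DIM('a)" "h = 2 ^ (DIM('a) - 1)"
  have h: "1 \<le> h" "m = 2 * h" using DIM_positive[where 'a='a] by (simp_all add: mh flip: power_Suc)
  show ?case
  proof (cases "n \<le> m")
    case True
    have "r ^ n \<le> r ^ m * 1" using True r by (simp add: power_increasing)
    also have "\<dots> \<le> r ^ m * real (q n)"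
      using r q_pos[OF less.prems] by (intro mult_left_mono) auto
    finally show ?thesis by (simp add: mh)
  next
    case False
    then obtain k where k: "n = k + m" "1 \<le> k"
      using that[of "n - m"] by simp
    have IH: "r ^ i \<le> r ^ m * real (q i)" if "1 \<le> i" "i < n" for i
      using less.IH[of i] that by (simp add: mh)
    from growth[OF k(2)] consider "2 * q (Suc k) \<le> q n" | "q (k + h) + q k \<le> q n"
      by (auto simp: mh k)
    then have "r ^ n \<le> r ^ m * real (q n)"
    proof cases
      case 1
      have "r ^ n = r ^ (m - 1) * r ^ Suc k" using k h by (subst power_add[symmetric]) (simp add: add.commute)
      also have "\<dots> \<le> 2 * r ^ Suc k"
        using r by (intro mult_right_mono) (simp_all add: mh)
      also have "\<dots> \<le> 2 * (r ^ m * real (q (Suc k)))"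
        using IH[of "Suc k"] k h by simp
      also have "\<dots> = r ^ m * real (2 * q (Suc k))" by simp
      also have "\<dots> \<le> r ^ m * real (q n)" using 1 r by (intro mult_left_mono) (simp_all del: of_nat_mult)
      finally show ?thesis .
    next
      case 2
      have "r ^ n = r ^ m * r ^ k" using k by (simp add: power_add)
      also have "\<dots> \<le> (r ^ h + 1) * r ^ k"
        using r by (intro mult_right_mono) (simp_all add: mh)
      also have "\<dots> = r ^ (k + h) + r ^ k" by (simp add: power_add algebra_simps)
      also have "\<dots> \<le> r ^ m * real (q (k + h)) + r ^ m * real (q k)"
        using k h by (intro add_mono IH) auto
      also have "\<dots> = r ^ m * real (q (k + h) + q k)" by (simp add: algebra_simps)
      also have "\<dots> \<le> r ^ m * real (q n)" using 2 r by (intro mult_left_mono) (simp_all del: of_nat_add)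
      finally show ?thesis .
    qed
    then show ?thesis by (simp add: mh)
  qed
qed

end

text \<open>The constant disappears because \<open>C powr - (1 / n)\<close> tends to
  \<open>1\<close>.\<close>

lemma liminf_root_ge:
  fixes r C :: real and a :: "nat \<Rightarrow> real"
  assumes "0 < r" "0 < C" "\<And>n. 1 \<le> n \<Longrightarrow> r ^ n \<le> C * a n"
  shows "ereal r \<le> liminf (\<lambda>n. ereal (a n powr (1 / real n)))"
proof -
  have "(\<lambda>n. C powr - (1 / real n) * r) \<longlonglongrightarrow> C powr - 0 * r"
    using assms(2) by (intro tendsto_intros lim_1_over_n) auto
  then have "(\<lambda>n. ereal (C powr - (1 / real n) * r)) \<longlonglongrightarrow> ereal r"
    using assms(2) by simp
  then have "ereal r = liminf (\<lambda>n. ereal (C powr - (1 / real n) * r))"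
    by (intro lim_imp_Liminf[symmetric]) auto
  also have "\<dots> \<le> liminf (\<lambda>n. ereal (a n powr (1 / real n)))"
  proof (rule Liminf_mono, rule eventually_sequentiallyI[of 1])
    fix n :: nat assume n: "1 \<le> n"
    have "C powr - (1 / real n) * r = (r ^ n / C) powr (1 / real n)"
      using n assms by (simp add: powr_divide powr_minus powr_powr field_simps flip: powr_realpow)
    also have "\<dots> \<le> a n powr (1 / real n)"
      using assms(3)[OF n] assms(1,2) by (intro powr_mono2) (auto simp: field_simps)
    finally show "ereal (C powr - (1 / real n) * r) \<le> ereal (a n powr (1 / real n))" by simp
  qed
  finally show ?thesis .
qed

theorem corollary3p3:
  fixes L :: "'a::euclidean_space set" and \<alpha> :: 'a and q :: "nat \<Rightarrow> nat"
  assumes "full_rank_lattice L"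
    and "\<And>n. n \<ge> 1 \<Longrightarrow> best_approx_denom L \<alpha> n = Some (q n)"
  shows "liminf (\<lambda>n. ereal (real (q n) powr (1 / real n))) \<ge>
    ereal (if DIM('a) = 1 then (1 + sqrt 5) / 2 else 2 powr (1 / (2 ^ DIM('a) - 1)))"
proof -
  interpret best_approximations L \<alpha> q
    by unfold_locales (use assms in auto)
  define r :: real
    where "r = (if DIM('a) = 1 then (1 + sqrt 5) / 2 else 2 powr (1 / (2 ^ DIM('a) - 1)))"
  define m h :: nat where mh: "m = 2 ^ DIM('a)" "h = 2 ^ (DIM('a) - 1)"
  have h: "m = 2 * h" using DIM_positive[where 'a='a] by (simp add: mh flip: power_Suc)
  have r: "1 \<le> r \<and> r ^ (m - 1) \<le> 2 \<and> r ^ m \<le> r ^ h + 1"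
  proof (cases "DIM('a) = 1")
    case True
    \<comment> \<open>Here \<open>m = 2\<close> and \<open>h = 1\<close>: the golden ratio satisfies
      \<open>r\<^sup>2 = r + 1\<close> and is at most \<open>2\<close>.\<close>
    have "1 \<le> sqrt 5" "sqrt 5 \<le> 3" by (auto intro: real_le_lsqrt)
    then show ?thesis
      using True by (simp add: r_def mh power2_eq_square field_simps)
  next
    case False
    then have d: "2 \<le> DIM('a)" using DIM_positive[where 'a='a] by linarith
    then have "2 ^ 1 \<le> h" unfolding mh by (intro power_increasing) auto
    then have h2: "2 \<le> h" by simp
    have r1: "r = 2 powr (1 / real (m - 1))" using False by (simp add: r_def mh of_nat_diff)
    have ge: "1 \<le> r" unfolding r1 by (rule ge_one_powr_ge_zero) auto
    have rm: "r ^ (m - 1) = 2"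
      unfolding r1 using h h2 by (simp add: powr_powr flip: powr_realpow)
    have "r ^ m = r ^ (m - 1) * r" using h h2 by (metis power_minus_mult mult_pos_pos pos2
      less_le_trans)
    \<comment> \<open>The product is \<open>2 * r\<close>, and
      \<open>(r - 1)\<^sup>2 \<ge> 0\<close>. Passing from \<open>r\<^sup>2\<close> to
      \<open>r ^ h\<close> uses \<open>h \<ge> 2\<close>, that is, dimension at least two.\<close>
    also have "\<dots> \<le> r\<^sup>2 + 1" using zero_le_power2[of "r - 1"] unfolding rm by (simp add: power2_diff)
    also have "\<dots> \<le> r ^ h + 1" using ge h2 by (simp add: power_increasing)
    finally show ?thesis using ge rm by simp
  qed
  have "ereal r \<le> liminf (\<lambda>n. ereal (real (q n) powr (1 / real n)))"
    by (rule liminf_root_ge[of _ "r ^ m"])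
      (use r exponential_lower_bound[of r] in \<open>auto simp: mh\<close>)
  then show ?thesis by (simp add: r_def)
qed

end
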